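(* Let $C$ be a convex body in $\mathbb{R}^2$, and let $p_1,p_2,p_1',p_2'\in\mathbb{R}^2$ be four points (not necessarily distinct) such that $I^\circ\neq\emptyset$ and $I'^\circ\neq\emptyset$, where $I=C_{p_1}\cap C_{p_2}$ and $I'=C_{p_1'}\cap C_{p_2'}$. Suppose that any three of $p_1,p_2,p_1',p_2'$ are not collinear unless two of them coincide. If the segments $[p_1,p_2]$ and $[p_1',p_2']$ do not cross and $I\cap I'\neq\emptyset$, then $I$ and $I'$ intersect plainly.
   Context: A convex body in $\mathbb{R}^2$ is a compact convex set with nonempty interior; $\partial C$ denotes its boundary and $C^\circ=C\setminus\partial C$ its interior. For $p\in\mathbb{R}^2$, $C_p=p+C$. Two convex bodies $C,D$ with $C\cap D\neq\emptyset$ intersect plainly if $\partial C\cap D$ and $\partial D\cap C$ are both connected (the empty set counts as connected). Two segments cross if they are not collinear and meet at a point that is interior to both. *)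

theory Defs
  imports "HOL-Analysis.Analysis"
begin

definition convex_body :: "(real^2) set \<Rightarrow> bool" where
  "convex_body C \<longleftrightarrow> compact C \<and> convex C \<and> interior C \<noteq> {}"

definition translate :: "real^2 \<Rightarrow> (real^2) set \<Rightarrow> (real^2) set" where
  "translate p C = (+) p ` C"

text \<open>The library predicate \<^const>\<open>connected\<close> holds of the empty set, as required here.\<close>

definition intersect_plainly :: "(real^2) set \<Rightarrow> (real^2) set \<Rightarrow> bool" where
  "intersect_plainly C D \<longleftrightarrow>
     convex_body C \<and> convex_body D \<and> C \<inter> D \<noteq> {} \<and>
     connected (frontier C \<inter> D) \<and> connected (frontier D \<inter> C)"

text \<open>
  The segments [a, b] and [c, d] cross. Two segments are collinear when they lie on a
  common line. A degenerate segment has no interior points, since \<^term>\<open>open_segment a a\<close> is empty.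
\<close>

definition segments_cross :: "real^2 \<Rightarrow> real^2 \<Rightarrow> real^2 \<Rightarrow> real^2 \<Rightarrow> bool" where
  "segments_cross a b c d \<longleftrightarrow>
     \<not> collinear (closed_segment a b \<union> closed_segment c d) \<and>
     open_segment a b \<inter> open_segment c d \<noteq> {}"

end

theory Submission
  imports Defs
begin

text \<open>
  Let J be the intersection of I and I', and let A be the part of the frontier of I in I', that is,
  the points of J that are not interior to the translate of C at some \<open>\<alpha>\<close> in {p1, p2}.
  An outer normal u of that translate at such a point a satisfies u(\<open>\<alpha>\<close>) \<open>\<le>\<close> u(p1'), u(p2'), because
  a - p1' and a - p2' lie in C. So a belongs to the set G(\<open>\<alpha>\<close>) of maximizers over J of the nonzero
  functionals in the dual cone of p1' - \<open>\<alpha>\<close> and p2' - \<open>\<alpha>\<close>. The nonzero part of this cone is connected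
  by general position, and the maximizers of each functional form a convex set, so G(\<open>\<alpha>\<close>) is connected.
  If there is at least one such point a, then G(\<open>\<alpha>\<close>) is contained in A. Hence A is G(p1), or
  G(p2), or their union. In the last case the two sets meet: since the segments do not cross, a
  functional w weakly separates them, and the maximizers of w over J lie in both sets.
\<close>

section \<open>Maximizers of linear functionals, normal cones and supports\<close>

text \<open>The set \<open>G\<close> of pairs of a functional and one of its maximizers projects
  onto \<open>T\<close> by a closed map, because \<open>J\<close> is compact, and the fibres are
  convex. Hence \<open>G\<close> is connected along with \<open>T\<close>, and so is its projection
  to \<open>J\<close>.\<close>

lemma connected_argmax:
  fixes J T :: "'a::euclidean_space set"
  assumes "compact J" "convex J" "connected T"
  shows "connected {y \<in> J. \<exists>f\<in>T. \<forall>z\<in>J. f \<bullet> z \<le> f \<bullet> y}"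
proof (cases "J = {}")
  case False
  define G where "G = {x \<in> T \<times> J. \<forall>z\<in>J. fst x \<bullet> z \<le> fst x \<bullet> snd x}"
  have closed: "closed {x :: 'a \<times> 'a. \<forall>z\<in>J. fst x \<bullet> z \<le> fst x \<bullet> snd x}"
    unfolding Ball_def imp_conv_disj
    by (intro closed_Collect_all closed_Collect_disj closed_Collect_le closed_Collect_const continuous_intros)
  have G: "closedin (top_of_set (T \<times> J)) G"
    unfolding closedin_closed using closed by (force simp: G_def)
  have fst_G: "fst ` G = T"
  proof -
    have "\<exists>y\<in>J. \<forall>z\<in>J. f \<bullet> z \<le> f \<bullet> y" for f
      by (rule continuous_attains_sup) (use assms False in \<open>auto intro!: continuous_intros\<close>)
    then show ?thesis by (force simp: G_def)
  qed
  have "connected (G \<inter> fst -` T)"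
  proof (rule connected_closed_monotone_preimage[OF _ fst_G])
    show "continuous_on G fst" by (intro continuous_intros)
    show "closedin (top_of_set T) (fst ` K)" if "closedin (top_of_set G) K" for K
      using Starlike.closed_map_fst[OF \<open>compact J\<close>] closedin_trans[OF that G] by blast
    show "connected (G \<inter> fst -` {f})" if "f \<in> T" for f
    proof -
      have "G \<inter> fst -` {f} = {f} \<times> (J \<inter> (\<Inter>z\<in>J. {y. f \<bullet> z \<le> f \<bullet> y}))"
        using that by (auto simp: G_def)
      moreover have "convex (J \<inter> (\<Inter>z\<in>J. {y. f \<bullet> z \<le> f \<bullet> y}))"
        by (intro convex_Int convex_INT \<open>convex J\<close>) (use convex_halfspace_ge in auto)
      ultimately show ?thesis
        by (simp add: connected_Times convex_connected)
    qed
  qed (use assms in auto)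
  then have "connected (snd ` (G \<inter> fst -` T))"
    by (intro connected_continuous_image continuous_intros)
  moreover have "snd ` (G \<inter> fst -` T) = {y \<in> J. \<exists>f\<in>T. \<forall>z\<in>J. f \<bullet> z \<le> f \<bullet> y}"
    by (force simp: G_def)
  ultimately show ?thesis by simp
qed auto

text \<open>From an interior point one can still move a little in the direction of \<open>f\<close>,
  which increases the functional.\<close>

lemma inner_less_max_interior:
  fixes f :: "'a::euclidean_space"
  assumes "f \<noteq> 0" "x \<in> interior S" "\<And>z. z \<in> S \<Longrightarrow> f \<bullet> z \<le> M"
  shows "f \<bullet> x < M"
proof -
  obtain e where e: "e > 0" "cball x e \<subseteq> S"
    using assms(2) by (meson mem_interior_cball)
  have "x + e *\<^sub>R sgn f \<in> S"
    using e assms(1) by (intro subsetD[OF e(2)]) (simp add: dist_norm norm_sgn)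
  then have "f \<bullet> (x + e *\<^sub>R sgn f) \<le> M" using assms(3) by blast
  moreover have "f \<bullet> sgn f > 0" using assms(1) by (simp add: sgn_div_norm)
  then have "e * (f \<bullet> sgn f) > 0" using e by simp
  ultimately show ?thesis by (simp add: inner_add_right)
qed

text \<open>Separating the set of all (x - z, t) with t \<open>\<le>\<close> f(x) - f(y), for x in S and z in T, from the
  ray of all (0, t) with t > 0 yields the splitting of f.\<close>

lemma normal_cone_Int:
  fixes S T :: "'a::euclidean_space set"
  assumes "convex S" "convex T" "interior (S \<inter> T) \<noteq> {}" "y \<in> S" "y \<in> T"
    and max: "\<And>z. z \<in> S \<Longrightarrow> z \<in> T \<Longrightarrow> f \<bullet> z \<le> f \<bullet> y"
  obtains g h where "f = g + h" "\<And>z. z \<in> S \<Longrightarrow> g \<bullet> z \<le> g \<bullet> y" "\<And>z. z \<in> T \<Longrightarrow> h \<bullet> z \<le> h \<bullet> y"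
proof -
  define H where "H = {(x - z, t) | x z t. x \<in> S \<and> z \<in> T \<and> t \<le> f \<bullet> x - f \<bullet> y}"
  have "convex H"
    unfolding convex_alt
  proof clarify
    fix d1 t1 d2 t2 and u :: real
    assume "(d1, t1) \<in> H" "(d2, t2) \<in> H" and u: "0 \<le> u" "u \<le> 1"
    then obtain x1 z1 x2 z2 where 1: "d1 = x1 - z1" "x1 \<in> S" "z1 \<in> T" "t1 \<le> f \<bullet> x1 - f \<bullet> y"
      and 2: "d2 = x2 - z2" "x2 \<in> S" "z2 \<in> T" "t2 \<le> f \<bullet> x2 - f \<bullet> y"
      unfolding H_def by auto
    have "(1 - u) *\<^sub>R x1 + u *\<^sub>R x2 \<in> S" "(1 - u) *\<^sub>R z1 + u *\<^sub>R z2 \<in> T"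
      using assms(1,2) 1 2 u by (auto simp: convex_alt)
    moreover have "(1 - u) * t1 + u * t2 \<le> (1 - u) * (f \<bullet> x1 - f \<bullet> y) + u * (f \<bullet> x2 - f \<bullet> y)"
      using 1 2 u by (intro add_mono mult_left_mono) auto
    moreover have "\<dots> = f \<bullet> ((1 - u) *\<^sub>R x1 + u *\<^sub>R x2) - f \<bullet> y"
      by (simp add: inner_add_right algebra_simps)
    ultimately show "(1 - u) *\<^sub>R (d1, t1) + u *\<^sub>R (d2, t2) \<in> H"
      unfolding H_def 1 2
      by (intro CollectI exI[of _ "(1 - u) *\<^sub>R x1 + u *\<^sub>R x2"] exI[of _ "(1 - u) *\<^sub>R z1 + u *\<^sub>R z2"]
            exI[of _ "(1 - u) * t1 + u * t2"]) (auto simp: algebra_simps)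
  qed
  moreover have "convex ({0::'a} \<times> {0::real<..})" by (intro convex_Times) auto
  moreover have "(y - y, 0) \<in> H" unfolding H_def using assms by force
  moreover have "H \<inter> {0} \<times> {0<..} = {}" using max by (force simp: H_def)
  moreover have "{0::'a} \<times> {0::real<..} \<noteq> {}" by (auto intro: exI[of _ 1])
  ultimately obtain a b where a: "a \<noteq> 0" "\<forall>x\<in>H. a \<bullet> x \<le> b" "\<forall>x\<in>{0} \<times> {0<..}. b \<le> a \<bullet> x"
    using separating_hyperplane_sets[of H "{0} \<times> {0<..}"] by blast
  obtain g c where [simp]: "a = (g, c)" by fastforce
  have pos: "b \<le> c * t" if "t > 0" for t
    using a(3) that by force
  \<comment> \<open>Let \<open>t\<close> tend to 0 along the ray; concretely,
    \<open>t = b / (2 * c)\<close> would give \<open>b \<le> b / 2\<close>.\<close>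
  have "b \<le> 0"
  proof (rule ccontr)
    assume "\<not> b \<le> 0"
    moreover from this have "c > 0" using pos[of 1] by simp
    ultimately show False using pos[of "b / (2 * c)"] by simp
  qed
  then have H: "g \<bullet> (x - z) + c * t \<le> 0" if "x \<in> S" "z \<in> T" "t \<le> f \<bullet> x - f \<bullet> y" for x z t
  proof -
    have "(x - z, t) \<in> H" using that by (auto simp: H_def)
    then show ?thesis using a(2) \<open>b \<le> 0\<close> by force
  qed
  have "c \<ge> 0" using H[OF assms(4,5), of "-1"] by simp
  \<comment> \<open>With \<open>c = 0\<close>, the nonzero \<open>g\<close> would be at most as
    large on \<open>S\<close> as on \<open>T\<close>, so an interior point of
    \<open>S \<inter> T\<close> would maximize it over \<open>S \<inter> T\<close>.\<close>
  moreover have "c \<noteq> 0"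
  proof
    assume "c = 0"
    then have "g \<noteq> 0" using a(1) by (auto simp: zero_prod_def)
    obtain x where x: "x \<in> interior (S \<inter> T)" using assms(3) by blast
    then have "x \<in> S" "x \<in> T" using interior_subset by auto
    have "g \<bullet> x < g \<bullet> x"
      using inner_less_max_interior[OF \<open>g \<noteq> 0\<close> x, of "g \<bullet> x"] H[OF _ \<open>x \<in> T\<close>] \<open>c = 0\<close>
      by (force simp: inner_diff_right)
    then show False by simp
  qed
  ultimately have c: "c > 0" by simp
  \<comment> \<open>After division by \<open>c\<close>, the first summand comes from pairing points
    of \<open>S\<close> with \<open>y\<close> at the largest allowed \<open>t\<close>, the second
    from pairing \<open>y\<close> with points of \<open>T\<close> at \<open>t = 0\<close>.\<close>
  show thesis
  proof
    show "f = (f + g /\<^sub>R c) + (- (g /\<^sub>R c))" by simp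
    show "(f + g /\<^sub>R c) \<bullet> z \<le> (f + g /\<^sub>R c) \<bullet> y" if "z \<in> S" for z
    proof -
      have "(c * (f \<bullet> z) + g \<bullet> z) / c \<le> (c * (f \<bullet> y) + g \<bullet> y) / c"
        using H[OF that assms(5) order_refl] c
        by (intro divide_right_mono) (auto simp: inner_diff_right algebra_simps)
      moreover have "(c * (f \<bullet> x) + g \<bullet> x) / c = (f + g /\<^sub>R c) \<bullet> x" for x
        using c by (simp add: inner_add_left field_simps)
      ultimately show ?thesis by simp
    qed
    show "- (g /\<^sub>R c) \<bullet> z \<le> - (g /\<^sub>R c) \<bullet> y" if "z \<in> T" for z
      using H[OF assms(4) that, of 0] c by (simp add: inner_diff_right field_simps)
  qed
qed

lemma convex_body_support:
  assumes "convex_body C" "y \<in> C" "y \<notin> interior C"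
  obtains u where "u \<noteq> 0" "\<And>z. z \<in> C \<Longrightarrow> u \<bullet> z \<le> u \<bullet> y"
proof -
  have "rel_interior C = interior C" "convex C" "closure C = C"
    using assms by (auto simp: convex_body_def rel_interior_nonempty_interior compact_imp_closed)
  then obtain a where "a \<noteq> 0" "\<And>z. z \<in> C \<Longrightarrow> a \<bullet> y \<le> a \<bullet> z"
    using supporting_hyperplane_relative_frontier[of C y] assms by metis
  then show thesis by (intro that[of "- a"]) auto
qed

section \<open>Cones in the plane and dual cones\<close>

text \<open>Cramer's rule, with \<open>D\<close> the determinant of \<open>d\<close> and
  \<open>e\<close>.\<close>

lemma noncollinear_basis:
  fixes d e x :: "real^2"
  assumes "\<not> collinear {0, d, e}"
  obtains s t where "x = s *\<^sub>R d + t *\<^sub>R e"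
proof -
  define D where "D = d$1 * e$2 - d$2 * e$1"
  have "D \<noteq> 0"
  proof
    assume "D = 0"
    then have eq: "d$1 * e$2 = d$2 * e$1" by (simp add: D_def)
    \<comment> \<open>Each coordinate of the difference of the two sides is a multiple of the
      vanishing determinant.\<close>
    have "(d \<bullet> d) *\<^sub>R e = (d \<bullet> e) *\<^sub>R d"
      using eq by (simp add: vec_eq_iff forall_2 inner_vec_def sum_2) algebra
    then have "d = 0 \<or> e = ((d \<bullet> e) / (d \<bullet> d)) *\<^sub>R d"
      by (metis (no_types, lifting) divide_inverse_commute inner_eq_zero_iff scaleR_scaleR
          left_inverse scaleR_one)
    then show False using assms by (auto simp: collinear_lemma)
  qed
  have "D *\<^sub>R x = (x$1 * e$2 - x$2 * e$1) *\<^sub>R d + (d$1 * x$2 - d$2 * x$1) *\<^sub>R e"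
    by (simp add: vec_eq_iff forall_2 D_def algebra_simps)
  then have "x = ((x$1 * e$2 - x$2 * e$1) / D) *\<^sub>R d + ((d$1 * x$2 - d$2 * x$1) / D) *\<^sub>R e"
    using \<open>D \<noteq> 0\<close>
    by (metis (no_types, lifting) divide_inverse_commute left_inverse scaleR_add_right scaleR_one scaleR_scaleR)
  then show thesis by (rule that)
qed

text \<open>The vector \<open>e\<close> lies in the cone spanned by \<open>d\<close> and
  \<open>d'\<close>, where \<open>u\<close> is nonnegative. Indeed, the signs of \<open>v\<close>
  and \<open>v'\<close> on \<open>e\<close> bound each coordinate of \<open>e\<close> in the basis
  \<open>d\<close>, \<open>d'\<close> by a positive multiple of the other. The product of the two
  factors exceeds 1, so both coordinates are nonnegative.\<close>

lemma obtuse_cone_nonneg: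
  fixes v v' u d d' e :: "real^2"
  assumes "v \<bullet> d < 0" "v' \<bullet> d' < 0" "(v + v') \<bullet> d \<ge> 0" "(v + v') \<bullet> d' \<ge> 0" "v + v' \<noteq> 0"
    and "u \<bullet> d \<ge> 0" "u \<bullet> d' \<ge> 0" "v \<bullet> e \<ge> 0" "v' \<bullet> e \<ge> 0" and nc: "\<not> collinear {0, d, d'}"
  shows "u \<bullet> e \<ge> 0"
proof -
  obtain x x' where e: "e = x *\<^sub>R d + x' *\<^sub>R d'" using noncollinear_basis[OF nc] by blast
  obtain s t where f: "v + v' = s *\<^sub>R d + t *\<^sub>R d'" using noncollinear_basis[OF nc] by blast
  define p where "p = (v + v') \<bullet> d"
  define q where "q = (v + v') \<bullet> d'"
  \<comment> \<open>The left side is positive, so \<open>p\<close> and \<open>q\<close> cannot both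
    vanish; the strictness of \<open>pos\<close> below rests on this.\<close>
  have "(v + v') \<bullet> (v + v') = s * p + t * q"
    by (subst (2) f) (simp add: p_def q_def inner_add_right)
  then have pq: "p > 0 \<or> q > 0"
    using assms(3-5) unfolding p_def q_def
    by (metis inner_eq_zero_iff less_eq_real_def add.right_neutral mult_zero_right)
  define a where "a = - (v \<bullet> d)"
  define b where "b = - (v' \<bullet> d')"
  have ab: "a > 0" "b > 0" "p \<ge> 0" "q \<ge> 0" using assms by (auto simp: a_def b_def p_def q_def)
  have vd: "v \<bullet> d = - a" "v' \<bullet> d = p + a" "v' \<bullet> d' = - b" "v \<bullet> d' = q + b"
    by (auto simp: a_def b_def p_def q_def inner_add_left)
  have 1: "x * a \<le> x' * (q + b)" and 2: "x' * b \<le> x * (p + a)"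
    using assms(8,9) by (auto simp: e inner_add_right vd)
  have "p * q + p * b + q * a > 0" using pq ab
    by (metis add_nonneg_pos add_pos_nonneg add_nonneg_nonneg mult_nonneg_nonneg mult_pos_pos less_eq_real_def)
  then have pos: "(p + a) * (q + b) - a * b > 0" by (simp add: algebra_simps)
  have "x * (a * b) \<le> x' * b * (q + b)" using mult_right_mono[OF 1, of b] ab by (simp add: algebra_simps)
  also have "\<dots> \<le> x * (p + a) * (q + b)" using mult_right_mono[OF 2, of "q + b"] ab by simp
  finally have "0 \<le> x * ((p + a) * (q + b) - a * b)" by (simp add: algebra_simps)
  then have "x \<ge> 0" using pos by (simp add: zero_le_mult_iff)
  then have "0 \<le> x' * (q + b)" using 1 ab by (meson mult_nonneg_nonneg order_trans less_imp_le)
  then have "x' \<ge> 0" using ab by (simp add: zero_le_mult_iff)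
  show ?thesis using \<open>x \<ge> 0\<close> \<open>x' \<ge> 0\<close> assms by (simp add: e inner_add_right)
qed

text \<open>The cone is convex with nonempty interior, so in dimension at least 2 it stays connected
  without the origin. Opposite \<open>d\<close> and \<open>e\<close> must be excluded: in the plane
  their dual cone is a line, which the origin disconnects.\<close>

lemma connected_dual_cone_minus_0:
  fixes d e :: "'a::euclidean_space"
  assumes "d = 0 \<or> e = 0 \<or> d = e \<or> \<not> collinear {0, d, e}" "DIM('a) \<noteq> 1"
  shows "connected ({f. 0 \<le> f \<bullet> d \<and> 0 \<le> f \<bullet> e} - {0})"
proof (rule connected_punctured_convex)
  define W where "W = {f. 0 \<le> f \<bullet> d \<and> 0 \<le> f \<bullet> e}"
  have W: "W = {f. 0 \<le> d \<bullet> f} \<inter> {f. 0 \<le> e \<bullet> f}" by (auto simp: W_def inner_commute)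
  then show "convex {f. 0 \<le> f \<bullet> d \<and> 0 \<le> f \<bullet> e}"
    unfolding W_def[symmetric] by (simp only: W) (intro convex_Int; use convex_halfspace_ge in auto)
  \<comment> \<open>This is the strict Cauchy-Schwarz inequality, except in the degenerate cases
    \<open>y = 0\<close> and \<open>x = y\<close>, where \<open>sgn x \<bullet> x = norm x\<close>
    suffices.\<close>
  have ineq: "(sgn x + sgn y) \<bullet> x > 0" if "x \<noteq> 0" "y = 0 \<or> x = y \<or> \<not> collinear {0, x, y}" for x y :: 'a
  proof -
    have "\<bar>x \<bullet> y\<bar> < norm x * norm y \<or> y = 0 \<or> x = y"
      using that(2) Cauchy_Schwarz_ineq2[of x y] norm_cauchy_schwarz_equal[of x y] by fastforce
    then consider "y = 0 \<or> x = y" | "y \<noteq> 0" "- (x \<bullet> y) < norm x * norm y" by fastforce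
    moreover have sgn: "sgn x \<bullet> x = norm x"
      using \<open>x \<noteq> 0\<close> by (simp add: sgn_div_norm dot_square_norm power2_eq_square)
    ultimately show ?thesis
    proof cases
      case 1
      then show ?thesis using sgn \<open>x \<noteq> 0\<close> by (auto simp: inner_add_left)
    next
      case 2
      have "(sgn x + sgn y) \<bullet> x = (norm x * norm y + x \<bullet> y) / norm y"
        using sgn 2(1) by (simp add: inner_add_left sgn_div_norm inner_commute[of y x] field_simps)
      then show ?thesis using 2 by simp
    qed
  qed
  \<comment> \<open>The angle bisector is an interior point of the cone. The alternatives
    \<open>d = 0\<close> and \<open>e = 0\<close> drop the strict condition for a zero vector, which
    no functional could satisfy.\<close>
  have "sgn d + sgn e \<in> {f. d = 0 \<or> f \<bullet> d > 0} \<inter> {f. e = 0 \<or> f \<bullet> e > 0}"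
    using ineq[of d e] ineq[of e d] assms(1) by (auto simp: insert_commute add.commute)
  moreover have "open ({f. d = 0 \<or> f \<bullet> d > 0} \<inter> {f. e = 0 \<or> f \<bullet> e > 0})"
    by (intro open_Int open_Collect_disj open_Collect_const open_Collect_less continuous_intros)
  moreover have "{f. d = 0 \<or> f \<bullet> d > 0} \<inter> {f. e = 0 \<or> f \<bullet> e > 0} \<subseteq> W"
    by (auto simp: W_def)
  ultimately have "interior W \<noteq> {}" using interior_maximal by blast
  then show "aff_dim {f. 0 \<le> f \<bullet> d \<and> 0 \<le> f \<bullet> e} \<noteq> 1"
    unfolding W_def[symmetric] using assms(2) by (simp add: aff_dim_nonempty_interior)
qed

section \<open>Separation of segments that do not cross\<close>

text \<open>If all four points lie on a line, a normal of the line takes equal values on them.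
  Otherwise the relative interiors are disjoint and can be separated, and the inequalities pass to
  the closures. For a segment that is a single point, disjointness comes from general
  position.\<close>

lemma weakly_separated_segments:
  assumes "\<not> segments_cross a b c d"
    and gp: "\<forall>x\<in>{a, b, c, d}. \<forall>y\<in>{a, b, c, d}. \<forall>z\<in>{a, b, c, d}.
          x \<noteq> y \<and> x \<noteq> z \<and> y \<noteq> z \<longrightarrow> \<not> collinear {x, y, z}"
  obtains w where "w \<noteq> 0" "\<And>x y. x \<in> {a, b} \<Longrightarrow> y \<in> {c, d} \<Longrightarrow> w \<bullet> x \<le> w \<bullet> y"
proof (cases "collinear (closed_segment a b \<union> closed_segment c d)")
  case True
  then obtain v where v: "\<And>x y. x \<in> closed_segment a b \<union> closed_segment c d \<Longrightarrow>
      y \<in> closed_segment a b \<union> closed_segment c d \<Longrightarrow> \<exists>k. x - y = k *\<^sub>R v"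
    unfolding collinear_def by blast
  obtain w where w: "w \<noteq> 0" "orthogonal v w"
    using orthogonal_to_vector_exists[of v] by auto
  show thesis
  proof (rule that[OF w(1)])
    fix x y assume "x \<in> {a, b}" "y \<in> {c, d}"
    then obtain k where "x - y = k *\<^sub>R v" using v[of x y] by auto
    then have "w \<bullet> (x - y) = 0" using w(2) by (simp add: orthogonal_def inner_commute)
    then show "w \<bullet> x \<le> w \<bullet> y" by (simp add: inner_diff_right)
  qed
next
  case False
  have triple: "z \<notin> open_segment x y" if "x \<in> {a, b, c, d}" "y \<in> {a, b, c, d}" "z \<in> {a, b, c, d}" for x y z
  proof
    assume z: "z \<in> open_segment x y"
    then have "x \<noteq> z \<and> z \<noteq> y \<and> x \<noteq> y" by (auto simp: open_segment_def)
    moreover have "collinear {x, z, y}"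
      using z by (intro between_imp_collinear) (simp add: between_mem_segment open_segment_def)
    ultimately show False using gp that by metis
  qed
  have "rel_interior (closed_segment a b) \<inter> rel_interior (closed_segment c d) = {}"
  proof -
    \<comment> \<open>This settles the case of two one-point segments: if they coincided, they would
      be collinear.\<close>
    have "a \<noteq> b \<or> c \<noteq> d \<or> a \<noteq> c" using False by auto
    then show ?thesis
      using triple False assms(1) by (auto simp: rel_interior_closed_segment segments_cross_def)
  qed
  then obtain w k where w: "w \<noteq> 0" "\<forall>x\<in>rel_interior (closed_segment a b). w \<bullet> x \<le> k"
      "\<forall>x\<in>rel_interior (closed_segment c d). k \<le> w \<bullet> x"
    using separating_hyperplane_sets[of "rel_interior (closed_segment a b)" "rel_interior (closed_segment c d)"]
    by (auto simp: convex_rel_interior rel_interior_eq_empty)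
  have closure: "closure (rel_interior (closed_segment x y)) = closed_segment x y" for x y :: "real^2"
    by (simp add: convex_closure_rel_interior)
  have "closed_segment a b \<subseteq> {x. w \<bullet> x \<le> k}"
    using w(2) closure_minimal[of "rel_interior (closed_segment a b)" "{x. w \<bullet> x \<le> k}"]
    by (auto simp: closure closed_halfspace_le)
  moreover have "closed_segment c d \<subseteq> {x. w \<bullet> x \<ge> k}"
    using w(3) closure_minimal[of "rel_interior (closed_segment c d)" "{x. w \<bullet> x \<ge> k}"]
    by (auto simp: closure closed_halfspace_ge)
  ultimately have "w \<bullet> a \<le> k" "w \<bullet> b \<le> k" "k \<le> w \<bullet> c" "k \<le> w \<bullet> d" by auto
  then show thesis by (intro that[OF w(1)]) auto
qed

section \<open>Translates of a convex body and the position of maximizers\<close>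

lemma mem_translate: "x \<in> translate p C \<longleftrightarrow> x - p \<in> C"
  unfolding translate_def by (auto simp: image_iff algebra_simps intro!: bexI[of _ "x - p"])

lemma mem_interior_translate: "x \<in> interior (translate p C) \<longleftrightarrow> x - p \<in> interior C"
  using mem_translate[of x p "interior C"] by (simp add: translate_def interior_translation)

lemma convex_body_translate: "convex_body C \<Longrightarrow> convex_body (translate p C)"
  by (auto simp: convex_body_def translate_def compact_translation interior_translation)

lemma convex_body_Int:
  "convex_body S \<Longrightarrow> convex_body T \<Longrightarrow> interior (S \<inter> T) \<noteq> {} \<Longrightarrow> convex_body (S \<inter> T)"
  by (auto simp: convex_body_def compact_Int convex_Int)

text \<open>After a shift by \<open>- p\<close>, the functional \<open>u\<close> attains its maximum
  over \<open>C\<close> at \<open>x - p\<close>, and \<open>x - q\<close> is a competing point of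
  \<open>C\<close>. If the latter is interior, it cannot be a maximizer.\<close>

lemma translate_max_imp_min:
  assumes "x \<in> translate p C" "x \<in> translate q C"
    and "\<And>z. z \<in> translate p C \<Longrightarrow> u \<bullet> z \<le> u \<bullet> x"
  shows "u \<bullet> p \<le> u \<bullet> q"
    and "u \<noteq> 0 \<Longrightarrow> x \<in> interior (translate q C) \<Longrightarrow> u \<bullet> p < u \<bullet> q"
proof -
  have max: "u \<bullet> z \<le> u \<bullet> (x - p)" if "z \<in> C" for z
    using assms(3)[of "z + p"] that by (simp add: mem_translate inner_add_right inner_diff_right)
  show "u \<bullet> p \<le> u \<bullet> q"
    using max[of "x - q"] assms(2) by (simp add: mem_translate inner_diff_right)
  show "u \<bullet> p < u \<bullet> q" if "u \<noteq> 0" "x \<in> interior (translate q C)"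
    using inner_less_max_interior[OF that(1), of "x - q" C, OF _ max] that(2)
    by (simp add: mem_interior_translate inner_diff_right)
qed

text \<open>If y were interior to I, then f = v + v' for outer normals v, v' at y of the translates at p', q'.
  An outer normal u at a of the translate at \<open>\<alpha>\<close> would then satisfy u(y) \<open>\<ge>\<close> u(a) by
  \<open>obtuse_cone_nonneg\<close>, although y is interior to that translate.\<close>

lemma maximizer_notin_interior:
  assumes C: "convex_body C" and I: "I = translate p C \<inter> translate q C"
    and I': "I' = translate p' C \<inter> translate q' C" "interior I' \<noteq> {}"
    and \<alpha>: "\<alpha> \<in> {p, q}"
    and gp: "p' = \<alpha> \<or> q' = \<alpha> \<or> p' = q' \<or> \<not> collinear {\<alpha>, p', q'}"
    and a: "a \<in> I \<inter> I'" "a \<notin> interior (translate \<alpha> C)"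
    and f: "f \<noteq> 0" "f \<bullet> \<alpha> \<le> f \<bullet> p'" "f \<bullet> \<alpha> \<le> f \<bullet> q'"
    and y: "y \<in> I \<inter> I'" "\<And>z. z \<in> I \<inter> I' \<Longrightarrow> f \<bullet> z \<le> f \<bullet> y"
  shows "y \<notin> interior I"
proof
  assume yI: "y \<in> interior I"
  have body: "convex_body (translate r C)" for r by (rule convex_body_translate[OF C])
  then have convex: "convex (translate r C)" for r by (auto simp: convex_body_def)
  have y\<alpha>: "y \<in> interior (translate \<alpha> C)" using yI \<alpha> by (auto simp: I)
  have mem: "y \<in> translate r C" "a \<in> translate r C" if "r \<in> {p, q, p', q'}" for r
    using y(1) a(1) that by (auto simp: I I')
  have "\<alpha> \<in> {p, q, p', q'}" using \<alpha> by auto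
  note mem\<alpha> = mem[OF this]
  \<comment> \<open>Since \<open>y\<close> is interior to \<open>I\<close>, the constraint
    \<open>I\<close> is inactive near \<open>y\<close>: a short step from \<open>y\<close> towards
    \<open>z\<close> stays in \<open>I\<close>, and convexity makes the local maximum over
    \<open>I'\<close> a global one.\<close>
  have local: "f \<bullet> z \<le> f \<bullet> y" if z: "z \<in> I'" for z
  proof -
    obtain e where e: "e > 0" "cball y e \<subseteq> I" using yI by (meson mem_interior_cball)
    \<comment> \<open>The bound 1 keeps the step on the segment from \<open>y\<close> to
      \<open>z\<close>; the summand 1 in the denominator covers \<open>z = y\<close>.\<close>
    define s where "s = min 1 (e / (norm (z - y) + 1))"
    have s: "0 < s" "s \<le> 1" using e by (auto simp: s_def add_nonneg_pos)
    have "s * norm (z - y) \<le> (e / (norm (z - y) + 1)) * norm (z - y)"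
      by (intro mult_right_mono) (auto simp: s_def)
    also have "\<dots> \<le> e"
      using e by (simp add: pos_divide_le_eq add_pos_nonneg algebra_simps)
    finally have "y + s *\<^sub>R (z - y) \<in> cball y e" using s by (simp add: dist_norm)
    then have "y + s *\<^sub>R (z - y) \<in> I" using e by blast
    moreover have "y + s *\<^sub>R (z - y) \<in> I'"
    proof -
      have "convex I'" unfolding I' by (intro convex_Int convex)
      then have "(1 - s) *\<^sub>R y + s *\<^sub>R z \<in> I'" using y(1) z s by (auto simp: convex_alt)
      then show ?thesis by (simp add: algebra_simps)
    qed
    ultimately have "f \<bullet> (y + s *\<^sub>R (z - y)) \<le> f \<bullet> y" using y(2) by blast
    then have "s * (f \<bullet> (z - y)) \<le> 0" by (simp add: inner_add_right)
    then have "f \<bullet> (z - y) \<le> 0" using s by (simp add: mult_le_0_iff)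
    then show ?thesis by (simp add: inner_diff_right)
  qed
  obtain v v' where fv: "f = v + v'"
    and v: "\<And>z. z \<in> translate p' C \<Longrightarrow> v \<bullet> z \<le> v \<bullet> y"
    and v': "\<And>z. z \<in> translate q' C \<Longrightarrow> v' \<bullet> z \<le> v' \<bullet> y"
    using normal_cone_Int[of "translate p' C" "translate q' C" y f] convex I' mem local by auto
  have v_less: "v \<bullet> (p' - \<alpha>) < 0" if "v \<noteq> 0"
    using translate_max_imp_min(2)[of y p' C \<alpha> v] mem[of p'] mem\<alpha> v that y\<alpha> by (simp add: inner_diff_right)
  have v'_less: "v' \<bullet> (q' - \<alpha>) < 0" if "v' \<noteq> 0"
    using translate_max_imp_min(2)[of y q' C \<alpha> v'] mem[of q'] mem\<alpha> v' that y\<alpha> by (simp add: inner_diff_right)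
  have f': "f \<bullet> (p' - \<alpha>) \<ge> 0" "f \<bullet> (q' - \<alpha>) \<ge> 0" using f by (auto simp: inner_diff_right)
  \<comment> \<open>If one summand were zero, \<open>f\<close> would be the other one, negative on a
    difference where \<open>f\<close> is nonnegative.\<close>
  have "v \<noteq> 0" "v' \<noteq> 0" using v_less v'_less f' f(1) fv by auto
  note less = v_less[OF \<open>v \<noteq> 0\<close>] v'_less[OF \<open>v' \<noteq> 0\<close>]
  \<comment> \<open>The strict signs exclude each coincidence; for \<open>p' = q'\<close> their sum
    would make \<open>f\<close> negative on \<open>p' - \<alpha>\<close>. Only the noncollinear
    alternative of \<open>gp\<close> is left.\<close>
  have "p' \<noteq> \<alpha>" "q' \<noteq> \<alpha>" "p' \<noteq> q'"
    using less f' by (auto simp: fv inner_add_left)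
  then have nc: "\<not> collinear {0, p' - \<alpha>, q' - \<alpha>}"
    using gp collinear_3[of p' \<alpha> q'] by (cases "p' = 0") (auto simp: insert_commute collinear_3_eq_affine_dependent)
  obtain u where u: "u \<noteq> 0" "\<And>z. z \<in> translate \<alpha> C \<Longrightarrow> u \<bullet> z \<le> u \<bullet> a"
    using convex_body_support[OF body mem\<alpha>(2) a(2)] by blast
  have "u \<bullet> (p' - \<alpha>) \<ge> 0" "u \<bullet> (q' - \<alpha>) \<ge> 0"
    using translate_max_imp_min(1)[of a \<alpha> C _ u] mem[of p'] mem[of q'] mem\<alpha> u(2)
    by (auto simp: inner_diff_right)
  moreover have "v \<bullet> (y - a) \<ge> 0" "v' \<bullet> (y - a) \<ge> 0"
    using v[of a] v'[of a] mem by (auto simp: inner_diff_right)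
  ultimately have "u \<bullet> (y - a) \<ge> 0"
    using obtuse_cone_nonneg[OF less _ _ _ _ _ _ _ nc] f' f(1) by (simp add: fv)
  moreover have "u \<bullet> y < u \<bullet> a" by (rule inner_less_max_interior[OF u(1) y\<alpha> u(2)])
  ultimately show False by (simp add: inner_diff_right)
qed

section \<open>Connectedness of the frontier parts and the conclusion\<close>

lemma connected_frontier_Int:
  assumes C: "convex_body C" and I: "I = translate p C \<inter> translate q C" "interior I \<noteq> {}"
    and I': "I' = translate p' C \<inter> translate q' C" "interior I' \<noteq> {}"
    and gp: "\<And>\<alpha>. \<alpha> \<in> {p, q} \<Longrightarrow> p' = \<alpha> \<or> q' = \<alpha> \<or> p' = q' \<or> \<not> collinear {\<alpha>, p', q'}"
    and w: "w \<noteq> 0" "\<And>\<alpha> \<beta>. \<alpha> \<in> {p, q} \<Longrightarrow> \<beta> \<in> {p', q'} \<Longrightarrow> w \<bullet> \<alpha> \<le> w \<bullet> \<beta>"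
  shows "connected (frontier I \<inter> I')"
proof -
  define J where "J = I \<inter> I'"
  define A where "A = frontier I \<inter> I'"
  define W where "W \<alpha> = {f. 0 \<le> f \<bullet> (p' - \<alpha>) \<and> 0 \<le> f \<bullet> (q' - \<alpha>)} - {0}" for \<alpha>
  define G where "G \<alpha> = {y \<in> J. \<exists>f\<in>W \<alpha>. \<forall>z\<in>J. f \<bullet> z \<le> f \<bullet> y}" for \<alpha>
  \<comment> \<open>The points of \<open>J\<close> on the frontier of the translate at
    \<open>\<alpha>\<close>: these two sets cover \<open>A\<close>, and the connected sets
    \<open>G \<alpha>\<close> are to be squeezed between them and \<open>A\<close>.\<close>
  define B where "B \<alpha> = J - interior (translate \<alpha> C)" for \<alpha>
  have body: "convex_body (translate r C)" for r by (rule convex_body_translate[OF C])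
  have bodies: "convex_body I" "convex_body I'"
    using I I' convex_body_Int body by auto
  then have "closed I" by (auto simp: convex_body_def compact_imp_closed)
  then have A: "A = J - interior I" by (auto simp: A_def J_def frontier_def)
  then have A_eq: "A = B p \<union> B q" by (auto simp: B_def I)
  have J: "compact J" "convex J"
    using bodies by (auto simp: J_def convex_body_def compact_Int convex_Int)
  have conn: "connected (G \<alpha>)" if "\<alpha> \<in> {p, q}" for \<alpha>
    unfolding G_def
  proof (rule connected_argmax[OF J])
    have "p' - \<alpha> = 0 \<or> q' - \<alpha> = 0 \<or> p' - \<alpha> = q' - \<alpha> \<or> \<not> collinear {0, p' - \<alpha>, q' - \<alpha>}"
      using gp[OF that] collinear_3[of p' \<alpha> q'] by (auto simp: insert_commute)
    then show "connected (W \<alpha>)"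
      unfolding W_def by (rule connected_dual_cone_minus_0) simp
  qed
  have BG: "B \<alpha> \<subseteq> G \<alpha>" if \<alpha>: "\<alpha> \<in> {p, q}" for \<alpha>
  proof
    fix a assume "a \<in> B \<alpha>"
    then have a: "a \<in> J" "a \<notin> interior (translate \<alpha> C)" by (auto simp: B_def)
    have mem: "a \<in> translate \<alpha> C" "a \<in> translate p' C" "a \<in> translate q' C"
      using a(1) \<alpha> by (auto simp: J_def I I')
    obtain u where u: "u \<noteq> 0" "\<And>z. z \<in> translate \<alpha> C \<Longrightarrow> u \<bullet> z \<le> u \<bullet> a"
      using convex_body_support[OF body mem(1) a(2)] by blast
    have "u \<in> W \<alpha>"
      using translate_max_imp_min(1)[OF mem(1) _ u(2)] mem u(1) by (auto simp: W_def inner_diff_right)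
    moreover have "J \<subseteq> translate \<alpha> C" using \<alpha> by (auto simp: J_def I)
    ultimately show "a \<in> G \<alpha>" using a(1) u(2) by (auto simp: G_def)
  qed
  have GA: "G \<alpha> \<subseteq> A" if \<alpha>: "\<alpha> \<in> {p, q}" and "B \<alpha> \<noteq> {}" for \<alpha>
  proof
    fix y assume "y \<in> G \<alpha>"
    then obtain f where f: "f \<in> W \<alpha>" "y \<in> J" "\<And>z. z \<in> J \<Longrightarrow> f \<bullet> z \<le> f \<bullet> y" by (auto simp: G_def)
    obtain a where "a \<in> J" "a \<notin> interior (translate \<alpha> C)" using \<open>B \<alpha> \<noteq> {}\<close> by (auto simp: B_def)
    then have "y \<notin> interior I"
      using f by (intro maximizer_notin_interior[OF C I(1) I' \<alpha> gp[OF \<alpha>], of a f y])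
        (auto simp: J_def W_def inner_diff_right)
    then show "y \<in> A" using f(2) by (simp add: A)
  qed
  have "connected A"
  proof (cases "B p = {} \<or> B q = {}")
    case True
    \<comment> \<open>If just one \<open>B \<alpha>\<close> is nonempty, it is all of
      \<open>A\<close>, and \<open>G \<alpha>\<close> lies between the two.\<close>
    then have "A = {} \<or> A = G p \<or> A = G q"
      using A_eq BG[of p] BG[of q] GA[of p] GA[of q] by blast
    then show ?thesis using conn by auto
  next
    case False
    then have "J \<noteq> {}" by (auto simp: B_def)
    then obtain m where m: "m \<in> J" "\<forall>z\<in>J. w \<bullet> z \<le> w \<bullet> m"
      using continuous_attains_sup[OF J(1) _ continuous_on_inner[OF continuous_on_const continuous_on_id], of w]
      by blast
    have "w \<in> W p" "w \<in> W q" using w by (auto simp: W_def inner_diff_right)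
    then have "G p \<inter> G q \<noteq> {}" using m by (auto simp: G_def)
    moreover have "A = G p \<union> G q"
      using False A_eq BG[of p] BG[of q] GA[of p] GA[of q] by blast
    ultimately show ?thesis using conn by (simp add: connected_Un)
  qed
  then show ?thesis by (simp add: A_def)
qed

theorem theorem3p3:
  fixes C I I' :: "(real^2) set" and p1 p2 p1' p2' :: "real^2"
  assumes "convex_body C"
    and "I = translate p1 C \<inter> translate p2 C"
    and "I' = translate p1' C \<inter> translate p2' C"
    and "interior I \<noteq> {}"
    and "interior I' \<noteq> {}"
    and "\<forall>a \<in> {p1, p2, p1', p2'}. \<forall>b \<in> {p1, p2, p1', p2'}. \<forall>c \<in> {p1, p2, p1', p2'}.
           a \<noteq> b \<and> a \<noteq> c \<and> b \<noteq> c \<longrightarrow> \<not> collinear {a, b, c}"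
    and "\<not> segments_cross p1 p2 p1' p2'"
    and "I \<inter> I' \<noteq> {}"
  shows "intersect_plainly I I'"
proof -
  let ?P = "{p1, p2, p1', p2'}"
  have gp: "b = a \<or> c = a \<or> b = c \<or> \<not> collinear {a, b, c}" if "a \<in> ?P" "b \<in> ?P" "c \<in> ?P" for a b c
    using assms(6) that by metis
  obtain w where w: "w \<noteq> 0" "\<And>x y. x \<in> {p1, p2} \<Longrightarrow> y \<in> {p1', p2'} \<Longrightarrow> w \<bullet> x \<le> w \<bullet> y"
    using weakly_separated_segments[OF assms(7,6)] by blast
  have "connected (frontier I \<inter> I')"
    using gp w(2) by (intro connected_frontier_Int[OF assms(1,2,4,3,5) _ w(1)]) auto
  moreover have "connected (frontier I' \<inter> I)"
    \<comment> \<open>Exchanging the two pairs of points reverses the separation, hence the sign of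
      \<open>w\<close>.\<close>
    using gp w by (intro connected_frontier_Int[OF assms(1,3,5,2,4), of "- w"]) auto
  moreover have "convex_body I" "convex_body I'"
    using assms convex_body_Int convex_body_translate by auto
  ultimately show ?thesis
    using assms(8) by (simp add: intersect_plainly_def)
qed

end
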